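(* Let $L>0$ and let $\beta:\mathbf{R}/2\pi\mathbf{Z}\to\mathbf{R}$ be a smooth function with $\beta(x+\pi)=-\beta(x)$ for all $x$, so that $\alpha(x)=\pi/2+\beta(x)$ solves $$\sin\alpha(x+\omega)-\sin\alpha(x-\omega)=L\left(\alpha'(x+\omega)+\alpha'(x-\omega)\right)$$ with $\omega=\pi/2$. There exists an infinitesimal deformation of this solution changing the rotation number (in the sense defined in the context, with deformation function $f$) if and only if $\beta$ satisfies the differential equation $$L^2\beta''=(C-\cos\beta)\sin\beta$$ for some constant $C$, and the respective function $f$ is given by $$Lf=C-\cos\beta .$$
   Context: Functions on $\mathbf{R}/2\pi\mathbf{Z}$ with $g(x+\pi)=-g(x)$ are called odd and those with $g(x+\pi)=g(x)$ are called even. Solutions $\alpha$ of the displayed equation with $\omega=\pi/2$ and $\alpha(x+\pi)=\pi-\alpha(x)$ correspond to bicycle curves with rotation number $1/2$ and chord length $2L$, where $\alpha(x)$ is the angle between the chord and the curve. An infinitesimal deformation of $\alpha=\pi/2+\beta$ changing the rotation number is a pair $(f,l)$, where $f:\mathbf{R}/2\pi\mathbf{Z}\to\mathbf{R}$ is a smooth even function and $l\in\mathbf{R}$, such that the displayed equation holds modulo $\varepsilon^2$ for all $x$ when $\omega$ is replaced by $\pi/2-\varepsilon$ (equivalently, the rotation number is $\rho=\omega/\pi=1/2-\varepsilon/\pi$), $\alpha$ is replaced by $\pi/2+\beta+\varepsilon f$, and $L$ is replaced by $L+\varepsilon l$. (Evenness of $f$ is the standing normalization: the odd part of a deformation does not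 change the rotation number and is incorporated into $\beta$.) *)

theory Defs
  imports "HOL-Analysis.Analysis" "HOL-Library.Landau_Symbols"
begin

text \<open>Functions on the circle of length \<open>2\<pi>\<close> are represented by \<open>2\<pi>\<close>-periodic functions on the reals.\<close>

definition smooth_on_circle :: "(real \<Rightarrow> real) \<Rightarrow> bool" where
  "smooth_on_circle g \<longleftrightarrow>
     (\<forall>x. g (x + 2 * pi) = g x) \<and> (\<forall>n. (deriv ^^ n) g differentiable_on UNIV)"

text \<open>The terms odd and even refer to the half-turn \<open>x \<mapsto> x + \<pi>\<close>, not to \<open>x \<mapsto> - x\<close>.\<close>

definition odd_on_circle :: "(real \<Rightarrow> real) \<Rightarrow> bool" where
  "odd_on_circle g \<longleftrightarrow> (\<forall>x. g (x + pi) = - g x)"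

definition even_on_circle :: "(real \<Rightarrow> real) \<Rightarrow> bool" where
  "even_on_circle g \<longleftrightarrow> (\<forall>x. g (x + pi) = g x)"

definition bicycle_lhs :: "real \<Rightarrow> (real \<Rightarrow> real) \<Rightarrow> real \<Rightarrow> real" where
  "bicycle_lhs \<omega> \<alpha> x = sin (\<alpha> (x + \<omega>)) - sin (\<alpha> (x - \<omega>))"

definition bicycle_rhs :: "real \<Rightarrow> real \<Rightarrow> (real \<Rightarrow> real) \<Rightarrow> real \<Rightarrow> real" where
  "bicycle_rhs L \<omega> \<alpha> x = L * (deriv \<alpha> (x + \<omega>) + deriv \<alpha> (x - \<omega>))"

definition solves_bicycle_equation :: "real \<Rightarrow> real \<Rightarrow> (real \<Rightarrow> real) \<Rightarrow> bool" where
  "solves_bicycle_equation L \<omega> \<alpha> \<longleftrightarrow> (\<forall>x. bicycle_lhs \<omega> \<alpha> x = bicycle_rhs L \<omega> \<alpha> x)"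

text \<open>
  An equation in \<open>\<epsilon>\<close> holds modulo \<open>\<epsilon>\<^sup>2\<close> if its two sides differ by \<open>O(\<epsilon>\<^sup>2)\<close> as \<open>\<epsilon> \<rightarrow> 0\<close>.
  Both signs of \<open>\<epsilon>\<close> are admitted, and \<open>\<epsilon> = 0\<close> is included by using the filter
  \<open>nhds 0\<close>. The deformed rotation number is \<open>(\<pi>/2 - \<epsilon>)/\<pi> = 1/2 - \<epsilon>/\<pi>\<close>.
\<close>

definition infinitesimal_deformation ::
    "real \<Rightarrow> (real \<Rightarrow> real) \<Rightarrow> (real \<Rightarrow> real) \<Rightarrow> real \<Rightarrow> bool" where
  "infinitesimal_deformation L \<beta> f l \<longleftrightarrow>
     smooth_on_circle f \<and> even_on_circle f \<and>
     (\<forall>x. (\<lambda>\<epsilon>. bicycle_lhs (pi / 2 - \<epsilon>) (\<lambda>y. pi / 2 + \<beta> y + \<epsilon> * f y) x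
              - bicycle_rhs (L + \<epsilon> * l) (pi / 2 - \<epsilon>) (\<lambda>y. pi / 2 + \<beta> y + \<epsilon> * f y) x)
          \<in> O[nhds 0](\<lambda>\<epsilon>. \<epsilon>\<^sup>2))"

lemma odd_solves_bicycle_equation:
  assumes "smooth_on_circle \<beta>" and "odd_on_circle \<beta>"
  shows "solves_bicycle_equation L (pi / 2) (\<lambda>y. pi / 2 + \<beta> y)"
proof -
  have D: "(\<beta> has_field_derivative deriv \<beta> y) (at y)" for y
  proof -
    have "\<beta> differentiable_on UNIV"
      using assms(1) unfolding smooth_on_circle_def by (metis funpow_0)
    then have "\<beta> differentiable (at y)"
      by (simp add: differentiable_on_def)
    then show ?thesis
      by (auto simp: real_differentiable_def DERIV_imp_deriv)
  qed
  have odd: "\<beta> (y + pi) = - \<beta> y" for y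
    using assms(2) by (simp add: odd_on_circle_def)
  have dshift: "deriv (\<lambda>y. pi / 2 + \<beta> y) y = deriv \<beta> y" for y
    by (intro DERIV_imp_deriv) (auto intro!: derivative_eq_intros D)
  have dodd: "deriv \<beta> (y + pi) = - deriv \<beta> y" for y
  proof -
    have "((\<lambda>y. \<beta> (y + pi)) has_field_derivative deriv \<beta> (y + pi)) (at y)"
      using D[of "y + pi"] by (simp add: DERIV_shift)
    moreover have "((\<lambda>y. \<beta> (y + pi)) has_field_derivative - deriv \<beta> y) (at y)"
      unfolding odd by (auto intro!: derivative_eq_intros D)
    ultimately show ?thesis by (rule DERIV_unique)
  qed
  have "bicycle_lhs (pi / 2) (\<lambda>y. pi / 2 + \<beta> y) x = bicycle_rhs L (pi / 2) (\<lambda>y. pi / 2 + \<beta> y) x" for x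
  proof -
    have e: "x + pi / 2 = (x - pi / 2) + pi"
      by simp
    show ?thesis
      unfolding bicycle_lhs_def bicycle_rhs_def dshift e odd dodd by (simp add: sin_add sin_diff)
  qed
  then show ?thesis
    by (simp add: solves_bicycle_equation_def)
qed

end

theory Submission
  imports Defs
begin

text \<open>
  After the substitution \<open>x = u + \<pi>/2\<close>, the parities of \<open>\<beta>\<close> and \<open>f\<close> turn the coefficient of
  \<open>\<epsilon>\<close> in the deformed equation into \<open>sin \<beta> (\<beta>' + f) = L (\<beta>'' + f')\<close>; the number \<open>l\<close> drops out.
  The terms \<open>sin \<beta> \<beta>'\<close> and \<open>f'\<close> are even under the half-turn and \<open>sin \<beta> f\<close> and \<open>\<beta>''\<close> are odd, so the
  equation splits into \<open>L f' = sin \<beta> \<beta>'\<close> and \<open>L \<beta>'' = f sin \<beta>\<close>. The first integrates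
  to \<open>L f = C - cos \<beta>\<close>, and then the second is the pendulum equation.
\<close>

text \<open>First-order Taylor expansion at 0: vanishing modulo \<open>e\<^sup>2\<close> amounts to
  vanishing of the linear coefficient. One direction compares the limit of \<open>h e / e\<close>
  with a bound linear in \<bar>e\<bar>. The other turns a linear bound on \<open>h'\<close> into a
  quadratic bound on \<open>h\<close> by the mean value inequality.\<close>

lemma bigo_square_nhds_zero_iff:
  fixes h h' :: "real \<Rightarrow> real"
  assumes h: "\<And>e. (h has_real_derivative h' e) (at e)"
    and h': "(h' has_real_derivative D) (at 0)" and "h 0 = 0"
  shows "h \<in> O[nhds 0](\<lambda>e. e\<^sup>2) \<longleftrightarrow> h' 0 = 0"
proof
  assume "h \<in> O[nhds 0](\<lambda>e. e\<^sup>2)"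
  then obtain c where c: "\<forall>\<^sub>F e in nhds 0. norm (h e) \<le> c * norm (e\<^sup>2)"
    by (rule landau_o.bigE)
  have "((\<lambda>e. h e / e) \<longlongrightarrow> h' 0) (at 0)"
    using h[of 0] \<open>h 0 = 0\<close> by (simp add: has_field_derivative_iff)
  moreover have "((\<lambda>e. h e / e) \<longlongrightarrow> 0) (at 0)"
  proof (rule Lim_null_comparison)
    show "\<forall>\<^sub>F e in at 0. norm (h e / e) \<le> c * \<bar>e\<bar>"
      using c unfolding eventually_at_filter
    proof eventually_elim
      case (elim e)
      then show ?case
        by (auto simp: field_simps power2_eq_square)
    qed
    show "((\<lambda>e. c * \<bar>e\<bar>) \<longlongrightarrow> 0) (at (0::real))"
      by (auto intro!: tendsto_eq_intros)
  qed
  ultimately show "h' 0 = 0"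
    by (rule tendsto_unique[rotated]) simp
next
  assume "h' 0 = 0"
  then have "((\<lambda>e. h' e / e) \<longlongrightarrow> D) (at 0)"
    using h' by (simp add: has_field_derivative_iff)
  then have "\<forall>\<^sub>F e in at 0. dist (h' e / e) D < 1"
    by (rule tendstoD) simp
  then obtain d where "d > 0" and d: "\<And>e. e \<noteq> 0 \<Longrightarrow> \<bar>e\<bar> < d \<Longrightarrow> dist (h' e / e) D < 1"
    unfolding eventually_at by (auto simp: dist_real_def)
  \<comment> \<open>The constant comes from \<open>h' e / e\<close> lying within distance 1 of its
    limit \<open>D\<close>.\<close>
  have h'_le: "\<bar>h' e\<bar> \<le> (\<bar>D\<bar> + 1) * \<bar>e\<bar>" if "\<bar>e\<bar> < d" for e
  proof (cases "e = 0")
    case False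
    then have "\<bar>h' e / e\<bar> \<le> \<bar>D\<bar> + 1"
      using d[of e] that by (simp add: dist_real_def)
    then show ?thesis
      using False by (simp add: abs_divide divide_le_eq)
  qed (simp add: \<open>h' 0 = 0\<close>)
  have h_le: "norm (h e) \<le> (\<bar>D\<bar> + 1) * norm (e\<^sup>2)" if "\<bar>e\<bar> < d" for e
  proof -
    \<comment> \<open>The bound on \<open>h'\<close> grows with the radius, so its value at
      \<bar>e\<bar> serves the whole ball; the increment from 0 to \<open>e\<close> supplies the
      second factor \<bar>e\<bar>.\<close>
    have "norm (h e - h 0) \<le> ((\<bar>D\<bar> + 1) * \<bar>e\<bar>) * norm (e - 0)"
    proof (rule field_differentiable_bound[where S = "cball 0 \<bar>e\<bar>" and f' = h'])
      fix z assume "z \<in> cball (0::real) \<bar>e\<bar>"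
      then have "\<bar>z\<bar> \<le> \<bar>e\<bar>"
        by (simp add: dist_real_def)
      moreover have "(\<bar>D\<bar> + 1) * \<bar>z\<bar> \<le> (\<bar>D\<bar> + 1) * \<bar>e\<bar>"
        using calculation by (intro mult_left_mono) auto
      ultimately show "norm (h' z) \<le> (\<bar>D\<bar> + 1) * \<bar>e\<bar>"
        using h'_le[of z] that by simp
    qed (auto intro: has_field_derivative_at_within h)
    then show ?thesis
      by (simp add: \<open>h 0 = 0\<close> power2_eq_square abs_mult mult.assoc)
  qed
  have "\<forall>\<^sub>F e in nhds 0. norm (h e) \<le> (\<bar>D\<bar> + 1) * norm (e\<^sup>2)"
    using h_le \<open>d > 0\<close> unfolding eventually_nhds_metric by (auto simp: dist_real_def)
  then show "h \<in> O[nhds 0](\<lambda>e. e\<^sup>2)"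
    by (rule bigoI)
qed

lemma smooth_on_circle_DERIV:
  assumes "smooth_on_circle g"
  shows "((deriv ^^ n) g has_real_derivative (deriv ^^ Suc n) g x) (at x)"
proof -
  have "(deriv ^^ n) g differentiable at x"
    using assms unfolding smooth_on_circle_def by (metis UNIV_I differentiable_on_def)
  then show ?thesis
    by (auto simp: real_differentiable_def DERIV_imp_deriv)
qed

text \<open>Treats both parities at once: with \<open>p = pi\<close>, the factor
  \<open>c = -1\<close> is the odd case and \<open>c = 1\<close> the even case, so parity passes to
  derivatives.\<close>

lemma deriv_shift_scaled:
  fixes g :: "real \<Rightarrow> real"
  assumes g: "\<And>y. (g has_real_derivative deriv g y) (at y)" and shift: "\<And>y. g (y + p) = c * g y"
  shows "deriv g (x + p) = c * deriv g x"
proof -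
  have "((\<lambda>y. g (y + p)) has_real_derivative deriv g (x + p)) (at x)"
    using g[of "x + p"] by (simp add: DERIV_shift)
  moreover have "((\<lambda>y. g (y + p)) has_real_derivative c * deriv g x) (at x)"
    unfolding shift by (rule DERIV_cmult[OF g])
  ultimately show ?thesis
    by (rule DERIV_unique)
qed

text \<open>A class of functions containing \<open>C - cos b\<close> that is closed under
  differentiation when \<open>b\<close> is smooth. It yields smoothness of the candidate
  \<open>f\<close> without a formula for its higher derivatives.\<close>

inductive_set trig_algebra :: "(real \<Rightarrow> real) \<Rightarrow> (real \<Rightarrow> real) set" for b where
  deriv: "(deriv ^^ n) b \<in> trig_algebra b"
| const: "(\<lambda>x. c) \<in> trig_algebra b"
| cos: "(\<lambda>x. cos (b x)) \<in> trig_algebra b"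
| sin: "(\<lambda>x. sin (b x)) \<in> trig_algebra b"
| add: "g \<in> trig_algebra b \<Longrightarrow> k \<in> trig_algebra b \<Longrightarrow> (\<lambda>x. g x + k x) \<in> trig_algebra b"
| mult: "g \<in> trig_algebra b \<Longrightarrow> k \<in> trig_algebra b \<Longrightarrow> (\<lambda>x. g x * k x) \<in> trig_algebra b"

lemma trig_algebra_DERIV:
  assumes b: "smooth_on_circle b" and "g \<in> trig_algebra b"
  shows "\<exists>g'\<in>trig_algebra b. \<forall>x. (g has_real_derivative g' x) (at x)"
  using assms(2)
proof induction
  case (deriv n)
  then show ?case
    using smooth_on_circle_DERIV[OF b] trig_algebra.deriv by blast
next
  case (const c)
  then show ?case
    by (intro bexI[OF _ trig_algebra.const[of 0]]) auto
next
  case cos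
  have "(\<lambda>x. (-1) * (sin (b x) * (deriv ^^ 1) b x)) \<in> trig_algebra b"
    by (intro trig_algebra.intros)
  then show ?case
    by (rule bexI[rotated])
      (auto intro!: derivative_eq_intros smooth_on_circle_DERIV[OF b, of 0, simplified])
next
  case sin
  have "(\<lambda>x. cos (b x) * (deriv ^^ 1) b x) \<in> trig_algebra b"
    by (intro trig_algebra.intros)
  then show ?case
    by (rule bexI[rotated])
      (auto intro!: derivative_eq_intros smooth_on_circle_DERIV[OF b, of 0, simplified])
next
  case (add g k)
  then obtain g' k' where *: "g' \<in> trig_algebra b" "k' \<in> trig_algebra b"
    "\<forall>x. (g has_real_derivative g' x) (at x)" "\<forall>x. (k has_real_derivative k' x) (at x)"
    by blast
  then have "(\<lambda>x. g' x + k' x) \<in> trig_algebra b"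
    by (intro trig_algebra.intros)
  with * show ?case
    by (intro bexI[of _ "\<lambda>x. g' x + k' x"]) (auto intro: DERIV_add)
next
  case (mult g k)
  then obtain g' k' where *: "g' \<in> trig_algebra b" "k' \<in> trig_algebra b"
    "\<forall>x. (g has_real_derivative g' x) (at x)" "\<forall>x. (k has_real_derivative k' x) (at x)"
    by blast
  with mult.hyps have "(\<lambda>x. g' x * k x + k' x * g x) \<in> trig_algebra b"
    by (intro trig_algebra.intros)
  with * show ?case
    by (intro bexI[of _ "\<lambda>x. g' x * k x + k' x * g x"]) (auto intro: DERIV_mult)
qed

lemma trig_algebra_differentiable:
  assumes b: "smooth_on_circle b" and g: "g \<in> trig_algebra b"
  shows "(deriv ^^ n) g differentiable_on UNIV"
proof -
  have deriv_closed: "deriv k \<in> trig_algebra b" if k: "k \<in> trig_algebra b" for k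
  proof -
    obtain k' where k': "k' \<in> trig_algebra b" "\<forall>x. (k has_real_derivative k' x) (at x)"
      using trig_algebra_DERIV[OF b k] by blast
    then have "deriv k = k'"
      by (auto intro: DERIV_imp_deriv)
    with k' show ?thesis
      by simp
  qed
  have "(deriv ^^ n) g \<in> trig_algebra b"
    by (induction n) (use g deriv_closed in auto)
  then show ?thesis
    using trig_algebra_DERIV[OF b]
    by (fastforce simp: differentiable_on_def real_differentiable_def)
qed

text \<open>For x = u + pi/2 the two shifted arguments are (u - e) + pi and u + e, so parity
  expresses everything through values near \<open>u\<close>. The number \<open>l\<close> drops out
  because at e = 0 it multiplies \<open>deriv b u - deriv b u\<close>.\<close>

lemma infinitesimal_deformation_iff:
  assumes b: "smooth_on_circle b" "odd_on_circle b"
    and f: "smooth_on_circle f" "even_on_circle f"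
  shows "infinitesimal_deformation L b f l \<longleftrightarrow>
    (\<forall>u. sin (b u) * (deriv b u + f u) = L * (deriv (deriv b) u + deriv f u))"
proof -
  note Db = smooth_on_circle_DERIV[OF b(1), of 0, simplified]
  note Db1 = smooth_on_circle_DERIV[OF b(1), of 1, simplified]
  note Db2 = smooth_on_circle_DERIV[OF b(1), of 2, simplified numeral_2_eq_2, simplified]
  note Df = smooth_on_circle_DERIV[OF f(1), of 0, simplified]
  note Df1 = smooth_on_circle_DERIV[OF f(1), of 1, simplified]
  note Df2 = smooth_on_circle_DERIV[OF f(1), of 2, simplified numeral_2_eq_2, simplified]
  note D = Db Db1 Db2 Df Df1 Df2
  note D_plus = D[THEN DERIV_chain2]
  have b_shift: "b (y + pi) = - b y" and f_shift: "f (y + pi) = f y" for y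
    using b(2) f(2) by (auto simp: odd_on_circle_def even_on_circle_def)
  have b'_shift: "deriv b (y + pi) = - deriv b y" for y
    using deriv_shift_scaled[OF Db, of pi "-1" y] b_shift by simp
  have f'_shift: "deriv f (y + pi) = deriv f y" for y
    using deriv_shift_scaled[OF Df, of pi 1 y] f_shift by simp
  define h where "h u e =
      bicycle_lhs (pi / 2 - e) (\<lambda>y. pi / 2 + b y + e * f y) (u + pi / 2)
      - bicycle_rhs (L + e * l) (pi / 2 - e) (\<lambda>y. pi / 2 + b y + e * f y) (u + pi / 2)" for u e
  \<comment> \<open>The derivative in \<open>e\<close> of the formula for \<open>h\<close>
    established in \<open>h_eq\<close>; the product rule for the factor \<open>L + e * l\<close>
    gives the last two summands.\<close>
  define h' where "h' u e =
      sin (b (u - e) - e * f (u - e)) * (deriv b (u - e) + f (u - e) - e * deriv f (u - e))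
      + sin (b (u + e) + e * f (u + e)) * (deriv b (u + e) + f (u + e) + e * deriv f (u + e))
      - (l * (deriv b (u + e) - deriv b (u - e) + e * (deriv f (u + e) + deriv f (u - e)))
         + (L + e * l) * (deriv (deriv b) (u + e) + deriv (deriv b) (u - e)
              + (deriv f (u + e) + deriv f (u - e))
              + e * (deriv (deriv f) (u + e) - deriv (deriv f) (u - e))))" for u e
  have h_eq: "h u e = cos (b (u - e) - e * f (u - e)) - cos (b (u + e) + e * f (u + e))
      - (L + e * l) * (deriv b (u + e) - deriv b (u - e) + e * (deriv f (u + e) + deriv f (u - e)))"
    for u e
  proof -
    have shift: "u + pi / 2 + (pi / 2 - e) = (u - e) + pi" "u + pi / 2 - (pi / 2 - e) = u + e"
      by simp_all
    have "deriv (\<lambda>y. pi / 2 + b y + e * f y) y = deriv b y + e * deriv f y" for y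
      by (intro DERIV_imp_deriv) (auto intro!: derivative_eq_intros Db Df)
    moreover have "sin (pi / 2 + y + z) = cos (y + z)" for y z :: real
      by (simp add: sin_add cos_add)
    moreover have "cos (- b (u - e) + e * f (u - e)) = cos (b (u - e) - e * f (u - e))"
      by (metis cos_minus minus_diff_eq uminus_add_conv_diff)
    ultimately show ?thesis
      unfolding h_def bicycle_lhs_def bicycle_rhs_def shift
      by (simp only: b_shift f_shift b'_shift f'_shift) (simp add: algebra_simps)
  qed
  have h_deriv: "(h u has_real_derivative h' u e) (at e)" for u e
    unfolding h_eq h'_def
    by (auto intro!: derivative_eq_intros D_plus simp: algebra_simps)
  \<comment> \<open>Only existence matters, so the value of the second derivative is left to the
    differentiation rules. It involves third derivatives of \<open>b\<close> and \<open>f\<close>,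
    supplied by \<open>Db2\<close> and \<open>Df2\<close>.\<close>
  have h'_deriv: "\<exists>D. (h' u has_real_derivative D) (at 0)" for u
    unfolding h'_def
    by (rule exI) (rule derivative_eq_intros D_plus refl)+
  have "h u \<in> O[nhds 0](\<lambda>e. e\<^sup>2) \<longleftrightarrow>
      sin (b u) * (deriv b u + f u) = L * (deriv (deriv b) u + deriv f u)" for u
  proof -
    have "h u 0 = 0"
      by (simp add: h_eq)
    then have "h u \<in> O[nhds 0](\<lambda>e. e\<^sup>2) \<longleftrightarrow> h' u 0 = 0"
      using h'_deriv[of u] bigo_square_nhds_zero_iff[of "h u" "h' u", OF h_deriv] by blast
    \<comment> \<open>The factor 2 arises since the terms at \<open>u - e\<close> and
      \<open>u + e\<close> contribute equally at e = 0.\<close>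
    also have "h' u 0 = 2 * (sin (b u) * (deriv b u + f u) - L * (deriv (deriv b) u + deriv f u))"
      by (simp add: h'_def algebra_simps)
    finally show ?thesis
      by simp
  qed
  moreover have "infinitesimal_deformation L b f l \<longleftrightarrow> (\<forall>u. h u \<in> O[nhds 0](\<lambda>e. e\<^sup>2))"
  proof
    assume "\<forall>u. h u \<in> O[nhds 0](\<lambda>e. e\<^sup>2)"
    \<comment> \<open>Translation by pi/2 is onto, so conditions for all \<open>u\<close> cover all
      points \<open>x\<close> of the definition.\<close>
    then have "h (x - pi / 2) \<in> O[nhds 0](\<lambda>e. e\<^sup>2)" for x
      by blast
    then show "infinitesimal_deformation L b f l"
      using f by (simp add: infinitesimal_deformation_def h_def[abs_def])
  qed (simp add: infinitesimal_deformation_def h_def[abs_def])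
  ultimately show ?thesis
    by simp
qed

text \<open>Both equations share the same \<open>C\<close>, the integration constant from solving
  for \<open>f\<close>. As \<open>l\<close> is absent on the right, a given \<open>f\<close> admits
  either every \<open>l\<close> or none.\<close>

lemma infinitesimal_deformation_iff_pendulum:
  assumes "L > 0" and b: "smooth_on_circle b" "odd_on_circle b"
  shows "infinitesimal_deformation L b f l \<longleftrightarrow>
    (\<exists>C. (\<forall>x. L\<^sup>2 * deriv (deriv b) x = (C - cos (b x)) * sin (b x)) \<and>
         (\<forall>x. L * f x = C - cos (b x)))"
proof
  note Db = smooth_on_circle_DERIV[OF b(1), of 0, simplified]
  note Db1 = smooth_on_circle_DERIV[OF b(1), of 1, simplified]
  have b_shift: "b (y + pi) = - b y" for y
    using b(2) by (auto simp: odd_on_circle_def)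
  {
    assume def: "infinitesimal_deformation L b f l"
    then have f: "smooth_on_circle f" "even_on_circle f"
      by (auto simp: infinitesimal_deformation_def)
    note Df = smooth_on_circle_DERIV[OF f(1), of 0, simplified]
    have f_shift: "f (y + pi) = f y" for y
      using f(2) by (auto simp: even_on_circle_def)
    have b'_shift: "deriv b (y + pi) = - deriv b y" for y
      using deriv_shift_scaled[OF Db, of pi "-1" y] b_shift by simp
    have b''_shift: "deriv (deriv b) (y + pi) = - deriv (deriv b) y" for y
      using deriv_shift_scaled[OF Db1, of pi "-1" y] b'_shift by simp
    have f'_shift: "deriv f (y + pi) = deriv f y" for y
      using deriv_shift_scaled[OF Df, of pi 1 y] f_shift by simp
    have eq: "sin (b u) * (deriv b u + f u) = L * (deriv (deriv b) u + deriv f u)" for u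
      using def infinitesimal_deformation_iff[OF b f] by blast
    \<comment> \<open>Moving by pi flips the signs of \<open>sin (b u)\<close>,
      \<open>deriv b u\<close> and \<open>deriv (deriv b) u\<close> and keeps \<open>f\<close> and
      its derivative. Adding this to \<open>eq\<close> isolates the even part, subtracting it the
      odd part.\<close>
    have eq_shift: "sin (b u) * (deriv b u - f u) = L * (deriv f u - deriv (deriv b) u)" for u
      using eq[of "u + pi"] unfolding b_shift b'_shift b''_shift f_shift f'_shift
      by (simp add: algebra_simps)
    have first: "L * deriv f u = sin (b u) * deriv b u" for u
      using eq[of u] eq_shift[of u] by (simp add: algebra_simps)
    have second: "L * deriv (deriv b) u = sin (b u) * f u" for u
      using eq[of u] eq_shift[of u] by (simp add: algebra_simps)
    \<comment> \<open>The even part says that this quantity is conserved; its value at 0 becomes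
      \<open>C\<close>.\<close>
    have "((\<lambda>x. L * f x + cos (b x)) has_real_derivative 0) (at x)" for x
      by (auto intro!: derivative_eq_intros Db Df simp: first mult.commute[of _ L])
    then have const: "L * f x + cos (b x) = L * f 0 + cos (b 0)" for x
      using DERIV_isconst_all by blast
    define C where "C = L * f 0 + cos (b 0)"
    have Lf: "L * f x = C - cos (b x)" for x
      using const[of x] by (simp add: C_def)
    moreover have "L\<^sup>2 * deriv (deriv b) x = (C - cos (b x)) * sin (b x)" for x
    proof -
      have "L\<^sup>2 * deriv (deriv b) x = (L * f x) * sin (b x)"
        using second[of x] by (simp add: power2_eq_square mult.assoc mult.commute)
      then show ?thesis
        by (simp add: Lf)
    qed
    ultimately show "\<exists>C. (\<forall>x. L\<^sup>2 * deriv (deriv b) x = (C - cos (b x)) * sin (b x)) \<and>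
         (\<forall>x. L * f x = C - cos (b x))"
      by blast
  }
  assume "\<exists>C. (\<forall>x. L\<^sup>2 * deriv (deriv b) x = (C - cos (b x)) * sin (b x)) \<and>
         (\<forall>x. L * f x = C - cos (b x))"
  then obtain C where
    ode: "\<And>x. L\<^sup>2 * deriv (deriv b) x = (C - cos (b x)) * sin (b x)"
    and Lf: "\<And>x. L * f x = C - cos (b x)"
    by blast
  \<comment> \<open>Written with a sum and a product of constants and \<open>cos (b x)\<close> to
    match the closure rules of \<open>trig_algebra\<close>.\<close>
  have f_eq: "f = (\<lambda>x. C / L + (- 1 / L) * cos (b x))"
    using Lf \<open>L > 0\<close> by (auto simp: fun_eq_iff field_simps)
  have "f \<in> trig_algebra b"
    unfolding f_eq by (intro trig_algebra.intros)
  \<comment> \<open>Evenness of \<open>f\<close> comes from oddness of \<open>b\<close> together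
    with evenness of the cosine.\<close>
  then have f: "smooth_on_circle f" "even_on_circle f"
    using b trig_algebra_differentiable[OF b(1)] b_shift
    by (auto simp: smooth_on_circle_def even_on_circle_def f_eq)
  have "sin (b u) * (deriv b u + f u) = L * (deriv (deriv b) u + deriv f u)" for u
  proof -
    have "(f has_real_derivative sin (b u) * deriv b u / L) (at u)"
      using \<open>L > 0\<close> unfolding f_eq by (auto intro!: derivative_eq_intros Db)
    then have "L * deriv f u = sin (b u) * deriv b u"
      using \<open>L > 0\<close> by (simp add: DERIV_imp_deriv)
    moreover have "L * (L * deriv (deriv b) u) = L * (sin (b u) * f u)"
      using ode[of u] by (simp add: Lf[of u, symmetric] power2_eq_square mult_ac)
    then have "L * deriv (deriv b) u = sin (b u) * f u"
      using \<open>L > 0\<close> by simp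
    ultimately show ?thesis
      by (simp add: algebra_simps)
  qed
  then show "infinitesimal_deformation L b f l"
    using infinitesimal_deformation_iff[OF b f] by blast
qed

theorem theorem8:
  fixes L :: real and \<beta> :: "real \<Rightarrow> real"
  assumes "L > 0"
    and "smooth_on_circle \<beta>"
    and "odd_on_circle \<beta>"
  shows "((\<exists>f l. infinitesimal_deformation L \<beta> f l) \<longleftrightarrow>
           (\<exists>C. \<forall>x. L\<^sup>2 * deriv (deriv \<beta>) x = (C - cos (\<beta> x)) * sin (\<beta> x))) \<and>
         (\<forall>f. (\<exists>l. infinitesimal_deformation L \<beta> f l) \<longleftrightarrow>
           (\<exists>C. (\<forall>x. L\<^sup>2 * deriv (deriv \<beta>) x = (C - cos (\<beta> x)) * sin (\<beta> x)) \<and>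
                (\<forall>x. L * f x = C - cos (\<beta> x))))"
proof -
  \<comment> \<open>Every solution of the differential equation with constant \<open>C\<close> thus
    comes with an \<open>f\<close>, so quantifying over \<open>f\<close> leaves only the condition
    on \<beta>.\<close>
  have "\<exists>f. \<forall>x. L * f x = C - cos (\<beta> x)" for C
    using \<open>L > 0\<close> by (intro exI[of _ "\<lambda>x. (C - cos (\<beta> x)) / L"]) simp
  then show ?thesis
    unfolding infinitesimal_deformation_iff_pendulum[OF assms] by blast
qed

end
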